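(* Let $\mathcal{P}=(\{\mathcal{E}_k:k\in K\},\{M_0,M_1\})$ be a concurrent quantum program on a Hilbert space $\mathcal{H}$ of finite dimension $d$ with orthonormal basis $\{|j\rangle\}_{j=1}^d$, and let $\rho_0$ be an initial density operator. Let $G$ be the matrix representation of the super-operator $\mathcal{G}=\frac{1}{|K|}\sum_{k\in K}\mathcal{F}_k$. Then the $d^2\times d^2$ matrix $I-G/2$ is invertible; putting $|x\rangle=(I-G/2)^{-1}(\rho_0\otimes I)|\Phi\rangle$ and $|y_j\rangle=(I\otimes\langle j|)|x\rangle\in\mathcal{H}$ for $j=1,\dots,d$, we have $\operatorname{span}\{|y_1\rangle,\dots,|y_d\rangle\}=\mathcal{H}_R$. In fact $|x\rangle=(\rho\otimes I)|\Phi\rangle$ with $\rho=\sum_{i=0}^\infty 2^{-i}\mathcal{G}^i(\rho_0)$ (a convergent series) and $\mathcal{H}_R=\operatorname{supp}(\rho)$.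
   Context: $\mathcal{H}$ is a complex Hilbert space of finite dimension $d\ge 1$. A super-operator on $\mathcal{H}$ is a completely positive linear map $\mathcal{E}$ on the space of linear operators on $\mathcal{H}$ with $\operatorname{tr}\mathcal{E}(\rho)\le\operatorname{tr}\rho$ for all positive $\rho$; every super-operator has a Kraus representation $\mathcal{E}(\rho)=\sum_i E_i\rho E_i^\dagger$. Its matrix representation (w.r.t. the basis $\{|j\rangle\}$) is the $d^2\times d^2$ matrix $\sum_i E_i\otimes E_i^*$, where $E^*$ is the entrywise complex conjugate. $|\Phi\rangle=\sum_{j=1}^d|j\rangle|j\rangle\in\mathcal{H}\otimes\mathcal{H}$. For positive semidefinite $\rho$, $\operatorname{supp}(\rho)$ is the span of eigenvectors with nonzero eigenvalues. A concurrent quantum program is a pair $\mathcal{P}=(\{\mathcal{E}_k:k\in K\},\{M_0,M_1\})$ with $K=\{1,\dots,m\}$, each $\mathcal{E}_k$ a trace-preserving super-operator on $\mathcal{H}$, and $M_0^\dagger M_0+M_1^\dagger M_1=I$. Define $\mathcal{F}_k(\rho)=\mathcal{E}_k(M_1\rho M_1^\dagger)$; for a finite string $f=s_1\cdots s_n$ over $K$, $\mathcal{F}_f=\mathcal{F}_{s_n}\circ\cdots\circ\mathcal{F}_{s_1}$ (identity for the empty string). The reachable space is $\mathcal{H}_R=\bigvee_{f\in K^*}\operatorname{supp}\mathcal{F}_f(\rho_0)$ (span of the union). *)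

theory Defs
  imports "HOL-Analysis.Analysis"
begin

text \<open>The Hilbert space H is modelled as complex^'n for a finite index type 'n
 (d = CARD('n)); operators on H are complex^'n^'n; H (x) H is complex^('n*'n)
 and d^2 x d^2 matrices are complex^('n*'n)^('n*'n).
 Complex linear spans are vec.span (span over the scalar field complex).\<close>

type_synonym 'n cmat = "complex^'n^'n"

definition adjoint :: "'n::finite cmat \<Rightarrow> 'n cmat" where
  "adjoint A = (\<chi> i j. cnj (A $ j $ i))"

definition mconj :: "'n::finite cmat \<Rightarrow> 'n cmat" where
  "mconj A = (\<chi> i j. cnj (A $ i $ j))"

definition kron :: "complex^'n::finite^'n \<Rightarrow> complex^'m::finite^'m \<Rightarrow> complex^('n\<times>'m)^('n\<times>'m)" where
  "kron A B = (\<chi> p q. A $ fst p $ fst q * B $ snd p $ snd q)"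

definition mtrace :: "'n::finite cmat \<Rightarrow> complex" where
  "mtrace A = (\<Sum>i\<in>UNIV. A $ i $ i)"

text \<open>|Phi> = sum_j |j>|j>\<close>
definition Phi :: "complex^('n::finite\<times>'n)" where
  "Phi = (\<chi> p. if fst p = snd p then 1 else 0)"

definition positive_semidef :: "'n::finite cmat \<Rightarrow> bool" where
  "positive_semidef A \<longleftrightarrow> adjoint A = A \<and>
     (\<forall>v::complex^'n. (\<Sum>i\<in>UNIV. cnj (v $ i) * (A *v v) $ i) \<in> \<real> \<and>
                        Re (\<Sum>i\<in>UNIV. cnj (v $ i) * (A *v v) $ i) \<ge> 0)"

definition density_operator :: "'n::finite cmat \<Rightarrow> bool" where
  "density_operator A \<longleftrightarrow> positive_semidef A \<and> mtrace A = 1"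

text \<open>supp(rho): span of the eigenvectors with nonzero eigenvalues\<close>
definition supp :: "'n::finite cmat \<Rightarrow> (complex^'n) set" where
  "supp A = vec.span {v. v \<noteq> 0 \<and> (\<exists>c. c \<noteq> 0 \<and> A *v v = c *s v)}"

text \<open>A super-operator given by a (finite) Kraus representation.\<close>
definition kraus_apply :: "'n::finite cmat list \<Rightarrow> 'n cmat \<Rightarrow> 'n cmat" where
  "kraus_apply Es \<rho> = (\<Sum>E\<leftarrow>Es. E ** \<rho> ** adjoint E)"

definition trace_preserving_kraus :: "'n::finite cmat list \<Rightarrow> bool" where
  "trace_preserving_kraus Es \<longleftrightarrow> (\<Sum>E\<leftarrow>Es. adjoint E ** E) = mat 1"

text \<open>Matrix representation sum_i E_i (x) E_i^*\<close>
definition superop_matrix :: "'n::finite cmat list \<Rightarrow> complex^('n\<times>'n)^('n\<times>'n)" where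
  "superop_matrix Es = (\<Sum>E\<leftarrow>Es. kron E (mconj E))"

text \<open>Concurrent program: m = |K| components, K = {1..m}, Kraus lists Es k of
  the trace-preserving super-operators E_k, measurement {M0, M1}.\<close>
definition is_concurrent_program ::
  "nat \<Rightarrow> (nat \<Rightarrow> 'n::finite cmat list) \<Rightarrow> 'n cmat \<Rightarrow> 'n cmat \<Rightarrow> bool" where
  "is_concurrent_program m Es M0 M1 \<longleftrightarrow> m \<ge> 1 \<and>
     (\<forall>k\<in>{1..m}. trace_preserving_kraus (Es k)) \<and>
     adjoint M0 ** M0 + adjoint M1 ** M1 = mat 1"

text \<open>F_k(rho) = E_k(M1 rho M1^dagger)\<close>
definition Fk :: "(nat \<Rightarrow> 'n::finite cmat list) \<Rightarrow> 'n cmat \<Rightarrow> nat \<Rightarrow> 'n cmat \<Rightarrow> 'n cmat" where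
  "Fk Es M1 k \<rho> = kraus_apply (Es k) (M1 ** \<rho> ** adjoint M1)"

text \<open>F_f = F_{s_n} o ... o F_{s_1} for f = s_1 ... s_n (identity for [])\<close>
definition Fstr :: "(nat \<Rightarrow> 'n::finite cmat list) \<Rightarrow> 'n cmat \<Rightarrow> nat list \<Rightarrow> 'n cmat \<Rightarrow> 'n cmat" where
  "Fstr Es M1 f \<rho> = fold (Fk Es M1) f \<rho>"

definition reachable_space ::
  "nat \<Rightarrow> (nat \<Rightarrow> 'n::finite cmat list) \<Rightarrow> 'n cmat \<Rightarrow> 'n cmat \<Rightarrow> (complex^'n) set" where
  "reachable_space m Es M1 \<rho>0 =
     vec.span (\<Union>f\<in>{f. set f \<subseteq> {1..m}}. supp (Fstr Es M1 f \<rho>0))"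

text \<open>G = (1/|K|) sum_k F_k, as a map and via its matrix representation\<close>
definition Gmap :: "nat \<Rightarrow> (nat \<Rightarrow> 'n::finite cmat list) \<Rightarrow> 'n cmat \<Rightarrow> 'n cmat \<Rightarrow> 'n cmat" where
  "Gmap m Es M1 \<rho> = (1 / real m) *\<^sub>R (\<Sum>k\<in>{1..m}. Fk Es M1 k \<rho>)"

text \<open>Kraus operators of F_k are E_{k,i} M1; matrix representation of G\<close>
definition Gmatrix :: "nat \<Rightarrow> (nat \<Rightarrow> 'n::finite cmat list) \<Rightarrow> 'n cmat \<Rightarrow> complex^('n\<times>'n)^('n\<times>'n)" where
  "Gmatrix m Es M1 = (1 / real m) *\<^sub>R
     (\<Sum>k\<in>{1..m}. superop_matrix (map (\<lambda>E. E ** M1) (Es k)))"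

end

theory Submission
  imports Defs
begin

text \<open>
  Proof outline.  Write \<open>G\<close> for the averaged map \<open>Gmap m Es M1\<close> and \<open>S i = 2^-i G^i(\<rho>0)\<close>.

  (1) \<open>G\<close> is linear, maps positive semidefinite (psd) matrices to psd matrices and
      does not increase the trace.  Since the entries of a psd matrix are bounded by
      its trace, every orbit \<open>G^i(X)\<close> of a psd \<open>X\<close> is bounded.
  (2) Hence \<open>\<rho> = \<Sum>i. S i\<close> converges, is psd, and satisfies \<open>\<rho> - G(\<rho>)/2 = \<rho>0\<close>.
  (3) Vectorising, \<open>(X \<otimes> I)|\<Phi>\<rangle> = vec X\<close> and \<open>G\<close>'s matrix acts as \<open>vec X \<mapsto> vec (G X)\<close>.
      By polarisation the vectorised psd matrices span the whole space, so all orbits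
      of the matrix \<open>G\<close> are bounded; thus \<open>2\<close> is no eigenvalue and \<open>I - G/2\<close> is
      invertible.  With (2) this gives \<open>x = vec \<rho>\<close>, so the \<open>y j\<close> are the columns of \<open>\<rho>\<close>.
  (4) For Hermitian \<open>P\<close>, \<open>supp P\<close> equals the range of \<open>P\<close> (an elementary spectral argument).
      The range of \<open>\<rho>\<close> equals the span of the ranges of all \<open>F_f(\<rho>0)\<close>: the kernel of
      the psd sum \<open>\<rho>\<close> lies in the kernel of every \<open>G^n(\<rho>0) \<ge> m^-n F_f(\<rho>0)\<close>, and
      conversely \<open>\<rho>\<close> is a limit of linear combinations of the \<open>F_f(\<rho>0)\<close>.
\<close>

subsection \<open>Sesquilinear form, adjoints and positive semidefinite matrices\<close>

definition cinner :: "complex^'n::finite \<Rightarrow> complex^'n \<Rightarrow> complex" where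
  "cinner u v = (\<Sum>i\<in>UNIV. cnj (u$i) * v$i)"

definition herm :: "'n::finite cmat \<Rightarrow> bool" where
  "herm A \<longleftrightarrow> adjoint A = A"

text \<open>The quadratic form \<open>\<langle>v, A v\<rangle>\<close>.\<close>
definition qf :: "'n::finite cmat \<Rightarrow> complex^'n \<Rightarrow> complex" where
  "qf A v = cinner v (A *v v)"

lemma psd_def2: "positive_semidef A \<longleftrightarrow> herm A \<and> (\<forall>v. qf A v \<in> \<real> \<and> Re (qf A v) \<ge> 0)"
  by (simp add: positive_semidef_def herm_def qf_def cinner_def)

text \<open>The real inner product of \<open>complex^n\<close> is the real part of the Hermitian one.\<close>
lemma inner_cinner: "inner u v = Re (cinner u v)"
  by (simp add: inner_vec_def cinner_def inner_complex_def Re_sum)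

lemma cinner_adjoint: "cinner u (A *v v) = cinner (adjoint A *v u) v"
proof -
  have "cinner u (A *v v) = (\<Sum>i\<in>UNIV. \<Sum>j\<in>UNIV. cnj (u$i) * A$i$j * v$j)"
    by (simp add: cinner_def matrix_vector_mult_def sum_distrib_left mult_ac)
  also have "\<dots> = (\<Sum>j\<in>UNIV. \<Sum>i\<in>UNIV. cnj (u$i) * A$i$j * v$j)"
    by (rule sum.swap)
  also have "\<dots> = cinner (adjoint A *v u) v"
    by (simp add: cinner_def adjoint_def matrix_vector_mult_def sum_distrib_right
        sum_distrib_left mult_ac)
  finally show ?thesis .
qed

lemma herm_sym: "herm A \<Longrightarrow> inner u (A *v v) = inner (A *v u) v"
  by (simp add: inner_cinner cinner_adjoint herm_def)

lemma mv_scaleR: "(A::complex^'n::finite^'m::finite) *v (r *\<^sub>R v) = r *\<^sub>R (A *v v)"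
  by (simp add: matrix_vector_mult_def vec_eq_iff scaleR_sum_right)

lemma scaleR_mv: "((r *\<^sub>R A)::complex^'n::finite^'m::finite) *v v = r *\<^sub>R (A *v v)"
  by (simp add: matrix_vector_mult_def vec_eq_iff scaleR_sum_right)

lemma scaleR_smult: "r *\<^sub>R (v::complex^'n::finite) = complex_of_real r *s v"
  by (simp add: vec_eq_iff) (simp add: scaleR_conv_of_real)

lemma mv_axis: "(A::complex^'n::finite^'m::finite) *v axis k 1 = (\<chi> i. A $ i $ k)"
  by (simp add: matrix_vector_mult_def vec_eq_iff axis_def if_distrib cong: if_cong)

lemma adjoint_mult: "adjoint (A ** B) = adjoint B ** adjoint (A::'n::finite cmat)"
  by (simp add: adjoint_def matrix_matrix_mult_def vec_eq_iff mult_ac)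

lemma adjoint_adjoint [simp]: "adjoint (adjoint A) = A"
  by (simp add: adjoint_def vec_eq_iff)

lemma adjoint_add: "adjoint (A + B) = adjoint A + adjoint B"
  by (simp add: adjoint_def vec_eq_iff)

lemma adjoint_scaleR: "adjoint (r *\<^sub>R A) = r *\<^sub>R adjoint A"
  by (simp add: adjoint_def vec_eq_iff)

lemma cinner_diff_left: "cinner (u - v) w = cinner u w - cinner v w"
  by (simp add: cinner_def algebra_simps sum_subtractf)

lemma cinner_smult_right: "cinner u (c *s w) = c * cinner u w"
  by (simp add: cinner_def sum_distrib_left mult_ac)

lemma cinner_smult_left: "cinner (c *s u) w = cnj c * cinner u w"
  by (simp add: cinner_def sum_distrib_left mult_ac)

lemma cinner_axis_left: "cinner (axis a 1) w = w $ a"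
proof -
  have h: "(\<lambda>i. cnj (axis a 1 $ i) * w $ i) = (\<lambda>i. if i = a then w$i else 0)"
    by (auto simp: axis_def)
  show ?thesis unfolding cinner_def h by simp
qed

lemma qf_add: "qf (A + B) v = qf A v + qf B v"
  by (simp add: qf_def matrix_vector_mult_add_rdistrib cinner_def algebra_simps sum.distrib)

lemma qf_diff: "qf (A - B) v = qf A v - qf B v"
  by (simp add: qf_def matrix_vector_mult_diff_rdistrib cinner_def algebra_simps sum_subtractf)

lemma qf_scaleR: "qf (r *\<^sub>R A) v = of_real r * qf A v"
  by (simp add: qf_def scaleR_mv scaleR_smult cinner_smult_right)

lemma psd_zero: "positive_semidef 0"
  by (simp add: psd_def2 herm_def adjoint_def qf_def cinner_def vec_eq_iff)

lemma psd_add: "positive_semidef A \<Longrightarrow> positive_semidef B \<Longrightarrow> positive_semidef (A + B)"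
  by (simp add: psd_def2 herm_def adjoint_add qf_add)

lemma psd_scaleR: "positive_semidef A \<Longrightarrow> r \<ge> 0 \<Longrightarrow> positive_semidef (r *\<^sub>R A)"
  by (auto simp: psd_def2 herm_def adjoint_scaleR qf_scaleR)

text \<open>Congruence \<open>P \<mapsto> E P E\<^sup>\<dagger>\<close> preserves positivity; this is why Kraus maps are positive.\<close>
lemma psd_conj: "positive_semidef P \<Longrightarrow> positive_semidef (E ** P ** adjoint E)"
proof -
  assume P: "positive_semidef P"
  have "herm (E ** P ** adjoint E)" using P
    by (simp add: psd_def2 herm_def adjoint_mult matrix_mul_assoc)
  moreover have "qf (E ** P ** adjoint E) v = qf P (adjoint E *v v)" for v
    by (simp add: qf_def matrix_vector_mul_assoc[symmetric] cinner_adjoint)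
  ultimately show ?thesis using P by (simp add: psd_def2)
qed

lemma psd_sum_list:
  "(\<And>x. x \<in> set xs \<Longrightarrow> positive_semidef (f x)) \<Longrightarrow> positive_semidef (\<Sum>x\<leftarrow>xs. f x)"
  by (induction xs) (auto simp: psd_zero psd_add)

lemma psd_sum:
  "finite S \<Longrightarrow> (\<And>x. x \<in> S \<Longrightarrow> positive_semidef (f x)) \<Longrightarrow> positive_semidef (\<Sum>x\<in>S. f x)"
  by (induction S rule: finite_induct) (auto simp: psd_zero psd_add)


subsection \<open>Trace and the size of positive semidefinite matrices\<close>

lemma mm_add_r: "(A + B) ** (C::complex^'p::finite^'n::finite) = A ** C + B ** C"
  by (vector matrix_matrix_mult_def sum.distrib[symmetric] field_simps)

lemma mm_diff_r: "(A - B) ** (C::complex^'p::finite^'n::finite) = A ** C - B ** C"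
  by (vector matrix_matrix_mult_def sum_subtractf[symmetric] field_simps)

lemma mm_scaleR_r: "(r *\<^sub>R A) ** (C::complex^'p::finite^'n::finite) = r *\<^sub>R (A ** C)"
  by (simp add: matrix_matrix_mult_def vec_eq_iff scaleR_sum_right)

lemma mm_scaleR_l: "(C::complex^'p::finite^'n::finite) ** (r *\<^sub>R A) = r *\<^sub>R (C ** A)"
  by (simp add: matrix_matrix_mult_def vec_eq_iff scaleR_sum_right)

lemma mtrace_add: "mtrace (A + B) = mtrace A + mtrace B"
  by (simp add: mtrace_def sum.distrib)

lemma mtrace_diff: "mtrace (A - B) = mtrace A - mtrace B"
  by (simp add: mtrace_def sum_subtractf)

lemma mtrace_zero [simp]: "mtrace 0 = 0"
  by (simp add: mtrace_def)

lemma mtrace_scaleR: "mtrace (r *\<^sub>R A) = of_real r * mtrace A"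
  by (simp add: mtrace_def sum_distrib_left) (simp add: scaleR_conv_of_real)

lemma mtrace_sum: "finite S \<Longrightarrow> mtrace (\<Sum>x\<in>S. f x) = (\<Sum>x\<in>S. mtrace (f x))"
  by (induction S rule: finite_induct) (auto simp: mtrace_add)

lemma mtrace_comm: "mtrace (A ** B) = mtrace (B ** (A::'n::finite cmat))"
proof -
  have "mtrace (A ** B) = (\<Sum>i\<in>UNIV. \<Sum>j\<in>UNIV. A$i$j * B$j$i)"
    by (simp add: mtrace_def matrix_matrix_mult_def)
  also have "\<dots> = (\<Sum>j\<in>UNIV. \<Sum>i\<in>UNIV. A$i$j * B$j$i)" by (rule sum.swap)
  also have "\<dots> = mtrace (B ** A)"
    by (simp add: mtrace_def matrix_matrix_mult_def mult_ac)
  finally show ?thesis .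
qed

lemma mtrace_conj: "mtrace (E ** X ** adjoint E) = mtrace ((adjoint E ** E) ** X)"
  by (metis matrix_mul_assoc mtrace_comm)

text \<open>A trace-preserving Kraus map preserves the trace of every matrix.\<close>
lemma mtrace_kraus_tp:
  assumes "trace_preserving_kraus Es"
  shows "mtrace (kraus_apply Es X) = mtrace X"
proof -
  have "mtrace (kraus_apply Es X) = mtrace ((\<Sum>E\<leftarrow>Es. adjoint E ** E) ** X)"
    by (induction Es) (simp_all add: kraus_apply_def mtrace_add mm_add_r mtrace_conj)
  with assms show ?thesis by (simp add: trace_preserving_kraus_def)
qed

lemma psd_diag: "positive_semidef P \<Longrightarrow> P$i$i \<in> \<real> \<and> Re (P$i$i) \<ge> 0"
proof -
  have "qf P (axis i 1) = P $ i $ i" by (simp add: qf_def mv_axis cinner_axis_left)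
  then show "positive_semidef P \<Longrightarrow> ?thesis" by (metis psd_def2)
qed

lemma psd_trace: "positive_semidef P \<Longrightarrow> mtrace P \<in> \<real> \<and> Re (mtrace P) \<ge> 0"
  unfolding mtrace_def using psd_diag[of P] by (auto intro!: sum_in_Reals sum_nonneg)

lemma psd_diag_le: "positive_semidef P \<Longrightarrow> Re (P$i$i) \<le> Re (mtrace P)"
  unfolding mtrace_def Re_sum using psd_diag[of P] by (intro member_le_sum) auto

text \<open>Every entry of a psd matrix is bounded by its trace: test the form on
  \<open>e_a - s e_b\<close> with the phase \<open>s\<close> chosen so that the cross terms become \<open>-2|P_ab|\<close>.\<close>
lemma psd_entry_le:
  assumes P: "positive_semidef P"
  shows "cmod (P$a$b) \<le> Re (mtrace P)"
proof (cases "a = b")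
  case True
  with psd_diag[OF P, of a] psd_diag_le[OF P, of a] show ?thesis
    by (metis Reals_cases Re_complex_of_real abs_of_nonneg norm_of_real)
next
  case False
  define c where "c = P$a$b"
  show ?thesis
  proof (cases "c = 0")
    case True then show ?thesis using psd_trace[OF P] by (simp add: c_def)
  next
    case c0: False
    have hc: "cmod c > 0" using c0 by simp
    define s where "s = cnj c / of_real (cmod c)"
    define v where "v = axis a 1 - s *s axis b (1::complex)"
    have herm: "P$b$a = cnj c"
      using P unfolding psd_def2 herm_def adjoint_def c_def
      by (metis (no_types, lifting) complex_cnj_cnj vec_lambda_beta)
    have q: "qf P v = P$a$a - s * c - cnj s * P$b$a + cnj s * s * P$b$b"
      by (simp add: qf_def v_def matrix_vector_mult_diff_distrib vector_scalar_commute mv_axis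
          cinner_diff_left cinner_smult_left cinner_axis_left algebra_simps c_def)
    have sc: "s * c = of_real (cmod c)"
      using hc by (simp add: s_def field_simps complex_norm_square[symmetric] power2_eq_square
          mult.commute)
    have ss: "cnj s * s = 1"
      using hc by (simp add: s_def field_simps complex_norm_square[symmetric] power2_eq_square)
    have cs: "cnj s * P$b$a = of_real (cmod c)"
      using sc by (metis herm complex_cnj_complex_of_real complex_cnj_mult)
    have "Re (qf P v) = Re (P$a$a) + Re (P$b$b) - 2 * cmod c"
      using q sc ss cs by simp
    moreover have "Re (qf P v) \<ge> 0" using P by (simp add: psd_def2)
    moreover have "Re (P$a$a) \<le> Re (mtrace P)" "Re (P$b$b) \<le> Re (mtrace P)"
      using psd_diag_le[OF P] by auto
    ultimately show ?thesis by (simp add: c_def)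
  qed
qed

lemma norm_mat_bound:
  assumes "\<And>i j. cmod (X$i$j) \<le> B"
  shows "norm (X::complex^'n::finite^'m::finite) \<le> real CARD('m) * (real CARD('n) * B)"
proof -
  have row: "norm (X$i) \<le> real CARD('n) * B" for i
  proof -
    have "norm (X$i) \<le> (\<Sum>j\<in>UNIV. cmod (X$i$j))"
      by (simp add: norm_vec_def L2_set_le_sum)
    also have "\<dots> \<le> (\<Sum>j\<in>(UNIV::'n set). B)"
      by (intro sum_mono assms)
    finally show ?thesis by simp
  qed
  have "norm X \<le> (\<Sum>i\<in>UNIV. norm (X$i))"
    by (simp add: norm_vec_def L2_set_le_sum)
  also have "\<dots> \<le> (\<Sum>i\<in>(UNIV::'m set). real CARD('n) * B)"
    by (intro sum_mono row)
  finally show ?thesis by simp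
qed

text \<open>Consequently a family of psd matrices with bounded traces is bounded.\<close>
lemma psd_bounded_trace_bounded:
  assumes "\<And>i. positive_semidef (P i :: 'n::finite cmat)" and "\<And>i. Re (mtrace (P i)) \<le> C"
  shows "bounded (range P)"
proof -
  have "norm (P i) \<le> real CARD('n) * (real CARD('n) * C)" for i
    using psd_entry_le[OF assms(1)] assms(2) by (intro norm_mat_bound) (meson order_trans)
  then show ?thesis by (auto simp: bounded_iff)
qed


subsection \<open>The averaged map \<open>G\<close>: linear, positive, trace non-increasing\<close>

lemma kraus_add: "kraus_apply Es (X + Y) = kraus_apply Es X + kraus_apply Es Y"
  by (induction Es) (simp_all add: kraus_apply_def matrix_add_ldistrib mm_add_r algebra_simps)

lemma kraus_scaleR: "kraus_apply Es (r *\<^sub>R X) = r *\<^sub>R kraus_apply Es X"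
  by (induction Es) (simp_all add: kraus_apply_def mm_scaleR_l mm_scaleR_r scaleR_add_right)

lemma Fk_add: "Fk Es M1 k (X + Y) = Fk Es M1 k X + Fk Es M1 k Y"
  by (simp add: Fk_def matrix_add_ldistrib mm_add_r kraus_add)

lemma Fk_scaleR: "Fk Es M1 k (r *\<^sub>R X) = r *\<^sub>R Fk Es M1 k X"
  by (simp add: Fk_def mm_scaleR_l mm_scaleR_r kraus_scaleR)

lemma linear_Gmap: "linear (Gmap m Es M1)"
  by (rule linearI) (simp_all add: Gmap_def Fk_add Fk_scaleR sum.distrib scaleR_add_right
      scaleR_sum_right[symmetric])

lemma Fk_psd: "positive_semidef X \<Longrightarrow> positive_semidef (Fk Es M1 k X)"
  unfolding Fk_def kraus_apply_def by (intro psd_sum_list psd_conj)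

lemma Gmap_psd: "positive_semidef X \<Longrightarrow> positive_semidef (Gmap m Es M1 X)"
  unfolding Gmap_def by (intro psd_scaleR psd_sum Fk_psd) auto

lemma Gmap_pow_psd: "positive_semidef X \<Longrightarrow> positive_semidef ((Gmap m Es M1 ^^ i) X)"
  by (induction i) (auto intro: Gmap_psd)

text \<open>Each \<open>F_k\<close> loses exactly the trace of the branch \<open>M0 X M0\<^sup>\<dagger>\<close> that leaves the loop.\<close>
lemma Fk_trace_le:
  assumes tp: "trace_preserving_kraus (Es k)"
    and M: "adjoint M0 ** M0 + adjoint M1 ** M1 = mat 1"
    and X: "positive_semidef X"
  shows "Re (mtrace (Fk Es M1 k X)) \<le> Re (mtrace X)"
proof -
  have "mtrace (Fk Es M1 k X) = mtrace ((adjoint M1 ** M1) ** X)"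
    by (simp add: Fk_def mtrace_kraus_tp[OF tp] mtrace_conj)
  also have "adjoint M1 ** M1 = mat 1 - adjoint M0 ** M0" using M by (simp add: algebra_simps)
  also have "mtrace ((mat 1 - adjoint M0 ** M0) ** X) = mtrace X - mtrace (M0 ** X ** adjoint M0)"
    by (simp add: mm_diff_r mtrace_diff mtrace_conj)
  finally have "Re (mtrace (Fk Es M1 k X)) = Re (mtrace X) - Re (mtrace (M0 ** X ** adjoint M0))"
    by simp
  moreover have "Re (mtrace (M0 ** X ** adjoint M0)) \<ge> 0"
    using psd_trace[OF psd_conj[OF X]] by blast
  ultimately show ?thesis by linarith
qed

lemma Gmap_trace_le:
  assumes P: "is_concurrent_program m Es M0 M1" and X: "positive_semidef X"
  shows "Re (mtrace (Gmap m Es M1 X)) \<le> Re (mtrace X)"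
proof -
  have m: "m \<ge> 1" and tp: "\<And>k. k \<in> {1..m} \<Longrightarrow> trace_preserving_kraus (Es k)"
    and M: "adjoint M0 ** M0 + adjoint M1 ** M1 = mat 1"
    using P by (auto simp: is_concurrent_program_def)
  have "Re (mtrace (Gmap m Es M1 X)) = (1 / real m) * (\<Sum>k\<in>{1..m}. Re (mtrace (Fk Es M1 k X)))"
    by (simp add: Gmap_def mtrace_scaleR mtrace_sum)
  also have "\<dots> \<le> (1 / real m) * (\<Sum>k\<in>{1..m}. Re (mtrace X))"
    by (intro mult_left_mono sum_mono Fk_trace_le[OF tp M X]) auto
  also have "\<dots> = Re (mtrace X)" using m by simp
  finally show ?thesis .
qed

text \<open>Hence the orbit of a psd matrix under \<open>G\<close> stays psd with trace at most the initial one,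
  so it is bounded.\<close>
lemma Gmap_orbit_bounded:
  assumes P: "is_concurrent_program m Es M0 M1" and X: "positive_semidef X"
  shows "bounded (range (\<lambda>i. (Gmap m Es M1 ^^ i) X))"
proof (rule psd_bounded_trace_bounded)
  show "positive_semidef ((Gmap m Es M1 ^^ i) X)" for i by (rule Gmap_pow_psd[OF X])
  show "Re (mtrace ((Gmap m Es M1 ^^ i) X)) \<le> Re (mtrace X)" for i
  proof (induction i)
    case (Suc i)
    have "Re (mtrace ((Gmap m Es M1 ^^ Suc i) X)) \<le> Re (mtrace ((Gmap m Es M1 ^^ i) X))"
      using Gmap_trace_le[OF P Gmap_pow_psd[OF X]] by simp
    with Suc show ?case by linarith
  qed simp
qed


subsection \<open>Vectorisation and invertibility of \<open>I - G/2\<close>\<close>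

text \<open>Row-major vectorisation \<open>vec X = \<Sum>a b. X_ab |a\<rangle>|b\<rangle>\<close>.\<close>
definition vecm :: "'n::finite cmat \<Rightarrow> complex^('n\<times>'n)" where
  "vecm X = (\<chi> p. X $ fst p $ snd p)"

lemma linear_vecm: "linear vecm"
  by (rule linearI) (simp_all add: vecm_def vec_eq_iff)

lemma sum_pair:
  "(\<Sum>p\<in>(UNIV::('a::finite\<times>'b::finite) set). f p) = (\<Sum>a\<in>UNIV. \<Sum>b\<in>UNIV. f (a,b))"
  by (simp add: UNIV_Times_UNIV[symmetric] sum.cartesian_product del: UNIV_Times_UNIV)

lemma kron_Phi: "kron X (mat 1) *v Phi = vecm X"
proof -
  have "(kron X (mat 1) *v Phi) $ (a,b) = X$a$b" for a b
  proof -
    have "(kron X (mat 1) *v Phi) $ (a,b)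
        = (\<Sum>c\<in>UNIV. \<Sum>d\<in>UNIV. X$a$c * (if b = d then 1 else 0) * (if c = d then 1 else 0))"
      by (simp add: matrix_vector_mult_def kron_def Phi_def sum_pair mat_def)
    also have "\<dots> = (\<Sum>c\<in>UNIV. \<Sum>d\<in>UNIV. if d = b then (if c = b then X$a$c else 0) else 0)"
      by (intro sum.cong refl) auto
    finally show ?thesis by simp
  qed
  then show ?thesis by (simp add: vec_eq_iff vecm_def)
qed

text \<open>The matrix \<open>E \<otimes> E\<^sup>*\<close> represents the congruence \<open>X \<mapsto> E X E\<^sup>\<dagger>\<close>.\<close>
lemma kron_vecm: "kron E (mconj E) *v vecm X = vecm (E ** X ** adjoint E)"
proof -
  have "(kron E (mconj E) *v vecm X) $ (a,b) = (E ** X ** adjoint E)$a$b" for a b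
  proof -
    have "(kron E (mconj E) *v vecm X) $ (a,b)
        = (\<Sum>c\<in>UNIV. \<Sum>d\<in>UNIV. E$a$c * cnj (E$b$d) * X$c$d)"
      by (simp add: matrix_vector_mult_def kron_def mconj_def vecm_def sum_pair)
    also have "\<dots> = (\<Sum>d\<in>UNIV. \<Sum>c\<in>UNIV. E$a$c * cnj (E$b$d) * X$c$d)" by (rule sum.swap)
    also have "\<dots> = (E ** X ** adjoint E)$a$b"
      by (simp add: matrix_matrix_mult_def adjoint_def sum_distrib_right sum_distrib_left mult_ac)
    finally show ?thesis .
  qed
  then show ?thesis by (simp add: vec_eq_iff vecm_def)
qed

lemma superop_vecm:
  "superop_matrix (map (\<lambda>E. E ** M1) Es) *v vecm X = vecm (kraus_apply Es (M1 ** X ** adjoint M1))"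
proof (induction Es)
  case Nil
  then show ?case by (simp add: superop_matrix_def kraus_apply_def linear_0[OF linear_vecm])
next
  case (Cons E Es)
  have "kron (E ** M1) (mconj (E ** M1)) *v vecm X = vecm (E ** (M1 ** X ** adjoint M1) ** adjoint E)"
    by (simp add: kron_vecm adjoint_mult matrix_mul_assoc)
  with Cons show ?case
    by (simp add: superop_matrix_def kraus_apply_def matrix_vector_mult_add_rdistrib
        linear_add[OF linear_vecm])
qed

lemma sum_mv:
  "finite S \<Longrightarrow> (\<Sum>k\<in>S. A k) *v (v::complex^'n::finite) = (\<Sum>k\<in>S. (A k :: complex^'n^'m::finite) *v v)"
  by (induction S rule: finite_induct) (simp_all add: matrix_vector_mult_add_rdistrib)

text \<open>\<open>Gmatrix\<close> is the matrix representation of \<open>G\<close> with respect to \<open>vecm\<close>.\<close>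
lemma Gmatrix_vecm: "Gmatrix m Es M1 *v vecm X = vecm (Gmap m Es M1 X)"
  by (simp add: Gmatrix_def Gmap_def scaleR_mv sum_mv superop_vecm Fk_def
      linear_scale[OF linear_vecm] linear_sum[OF linear_vecm])

lemma Gmatrix_pow_vecm: "((*v) (Gmatrix m Es M1) ^^ i) (vecm X) = vecm ((Gmap m Es M1 ^^ i) X)"
  by (induction i) (simp_all add: Gmatrix_vecm)

definition outer :: "complex^'n::finite \<Rightarrow> complex^'n \<Rightarrow> 'n cmat" where
  "outer p q = (\<chi> x y. p$x * cnj (q$y))"

lemma outer_psd: "positive_semidef (outer w w)"
proof -
  have "herm (outer w w)" by (simp add: herm_def adjoint_def outer_def vec_eq_iff mult.commute)
  moreover have "qf (outer w w) v = of_real ((cmod (cinner v w))^2)" for v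
  proof -
    have "outer w w *v v = cnj (cinner v w) *s w"
      by (simp add: outer_def matrix_vector_mult_def vec_eq_iff cinner_def sum_distrib_left mult_ac)
    then have "qf (outer w w) v = cinner v w * cnj (cinner v w)"
      by (simp add: qf_def cinner_smult_right mult.commute)
    also have "\<dots> = of_real ((cmod (cinner v w))^2)" by (rule complex_norm_square[symmetric])
    finally show ?thesis .
  qed
  ultimately show ?thesis by (simp add: psd_def2)
qed

text \<open>Polarisation: every rank-one matrix \<open>|p\<rangle>\<langle>q|\<close> is a complex combination of four psd ones.\<close>
lemma outer_polar: "vecm (outer p q) = (1/4) *s (vecm (outer (p + q) (p + q)) - vecm (outer (p - q) (p - q))
   + \<i> *s vecm (outer (p + \<i> *s q) (p + \<i> *s q)) - \<i> *s vecm (outer (p - \<i> *s q) (p - \<i> *s q)))"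
proof -
  have polar4: "(a::complex) * d = (a + b) * (c + d) / 4 - (a - b) * (c - d) / 4
      + \<i> * ((a + \<i> * b) * (c - \<i> * d)) / 4 - \<i> * ((a - \<i> * b) * (c + \<i> * d)) / 4"
    for a b c d by (simp add: field_simps)
  have entry: "p$a * cnj (q$b) = (p$a + q$a) * (cnj (p$b) + cnj (q$b)) / 4
      - (p$a - q$a) * (cnj (p$b) - cnj (q$b)) / 4
      + \<i> * ((p$a + \<i> * q$a) * (cnj (p$b) - \<i> * cnj (q$b))) / 4
      - \<i> * ((p$a - \<i> * q$a) * (cnj (p$b) + \<i> * cnj (q$b))) / 4" for a b
    by (rule polar4)
  show ?thesis by (simp add: vec_eq_iff vecm_def outer_def entry)
qed

text \<open>Hence the vectorised psd matrices span the whole space \<open>\<complex>^(n\<times>n)\<close>.\<close>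
lemma span_vecm_psd: "vec.span (vecm ` {P::'n::finite cmat. positive_semidef P}) = UNIV"
proof -
  let ?V = "vec.span (vecm ` {P::'n cmat. positive_semidef P})"
  have psd_in: "vecm (outer w w) \<in> ?V" for w :: "complex^'n"
    by (intro vec.span_base imageI) (simp add: outer_psd)
  have outer_in: "vecm (outer p q) \<in> ?V" for p q :: "complex^'n"
    by (subst outer_polar) (intro vec.span_scale vec.span_add vec.span_diff psd_in)
  have axis_in: "axis p 1 \<in> ?V" for p :: "'n \<times> 'n"
  proof -
    have "axis p (1::complex) = vecm (outer (axis (fst p) 1) (axis (snd p) 1))"
      unfolding vec_eq_iff vecm_def outer_def axis_def by (auto simp: prod_eq_iff)
    then show ?thesis using outer_in by simp
  qed
  have "z \<in> ?V" for z
  proof -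
    have "z = (\<Sum>p\<in>UNIV. z$p *s axis p 1)" by (rule basis_expansion[symmetric])
    also have "\<dots> \<in> ?V" by (intro vec.span_sum vec.span_scale axis_in)
    finally show ?thesis .
  qed
  then show ?thesis by blast
qed

text \<open>Iterates of a matrix are complex-linear.\<close>
lemma mv_pow_add: "((*v) (G::complex^'k::finite^'k) ^^ i) (x + y) = ((*v) G ^^ i) x + ((*v) G ^^ i) y"
  by (induction i) (simp_all add: matrix_vector_right_distrib)

lemma mv_pow_smult: "((*v) (G::complex^'k::finite^'k) ^^ i) (c *s x) = c *s ((*v) G ^^ i) x"
  by (induction i) (simp_all add: vector_scalar_commute)

lemma bounded_linear_smult: "bounded_linear (\<lambda>v::complex^'k::finite. c *s v)"
  by (rule linear_conv_bounded_linear[THEN iffD1], rule linearI) (simp_all add: vec_eq_iff algebra_simps)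

text \<open>All orbits of the matrix \<open>G\<close> are bounded: the vectors with bounded orbit form a
  complex subspace which contains every vectorised psd matrix.\<close>
lemma Gmatrix_orbit_bounded:
  assumes P: "is_concurrent_program m Es M0 M1"
  shows "bounded (range (\<lambda>i. ((*v) (Gmatrix m Es M1) ^^ i) z))"
proof -
  let ?orb = "\<lambda>z. range (\<lambda>i. ((*v) (Gmatrix m Es M1) ^^ i) z)"
  have "vec.subspace {z. bounded (?orb z)}"
  proof (unfold vec.subspace_def, intro conjI allI impI ballI)
    have "((*v) (Gmatrix m Es M1) ^^ i) 0 = 0" for i by (induction i) simp_all
    then show "0 \<in> {z. bounded (?orb z)}" by simp
  next
    fix c :: complex and x assume "x \<in> {z. bounded (?orb z)}"
    then have "bounded ((\<lambda>v. c *s v) ` ?orb x)"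
      by (intro bounded_linear_image bounded_linear_smult) simp
    then show "c *s x \<in> {z. bounded (?orb z)}" by (simp add: mv_pow_smult image_image)
  next
    fix x y assume "x \<in> {z. bounded (?orb z)}" "y \<in> {z. bounded (?orb z)}"
    then show "x + y \<in> {z. bounded (?orb z)}" by (simp add: mv_pow_add bounded_plus_comp)
  qed
  moreover have "vecm ` {P. positive_semidef P} \<subseteq> {z. bounded (?orb z)}"
  proof clarify
    fix X :: "'a cmat" assume "positive_semidef X"
    then have "bounded (vecm ` range (\<lambda>i. (Gmap m Es M1 ^^ i) X))"
      by (intro bounded_linear_image Gmap_orbit_bounded[OF P]
          linear_conv_bounded_linear[THEN iffD1, OF linear_vecm])
    then show "bounded (?orb (vecm X))" by (simp add: Gmatrix_pow_vecm image_image)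
  qed
  ultimately have "vec.span (vecm ` {P. positive_semidef P}) \<subseteq> {z. bounded (?orb z)}"
    by (rule vec.span_minimal[rotated])
  then show ?thesis using span_vecm_psd by blast
qed

text \<open>Since orbits are bounded, \<open>G\<close> has no eigenvalue 2, i.e. \<open>I - G/2\<close> is injective.\<close>
lemma I_minus_half_Gmatrix_invertible:
  assumes P: "is_concurrent_program m Es M0 M1"
  shows "invertible ((mat 1 :: complex^('n::finite\<times>'n)^('n\<times>'n)) - (1/2::real) *\<^sub>R Gmatrix m Es M1)"
  unfolding invertible_left_inverse matrix_left_invertible_ker
proof (intro allI impI)
  fix z assume "((mat 1 :: complex^('n\<times>'n)^('n\<times>'n)) - (1/2::real) *\<^sub>R Gmatrix m Es M1) *v z = 0"
  then have "z = (1/2::real) *\<^sub>R (Gmatrix m Es M1 *v z)"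
    by (simp add: matrix_vector_mult_diff_rdistrib scaleR_mv)
  then have "2 *\<^sub>R z = 2 *\<^sub>R ((1/2::real) *\<^sub>R (Gmatrix m Es M1 *v z))" by simp
  then have Gz: "Gmatrix m Es M1 *v z = 2 *\<^sub>R z" by simp
  have pow: "((*v) (Gmatrix m Es M1) ^^ i) z = (2^i) *\<^sub>R z" for i
    by (induction i) (simp_all add: mv_scaleR Gz)
  obtain B where B: "\<And>i. 2^i * norm z \<le> B"
    using Gmatrix_orbit_bounded[OF P, of z] by (auto simp: bounded_iff pow)
  show "z = 0"
  proof (rule ccontr)
    assume "z \<noteq> 0"
    then have "norm z > 0" by simp
    obtain n where "B / norm z < 2^n" using real_arch_pow[of 2 "B / norm z"] by auto
    with B[of n] \<open>norm z > 0\<close> show False by (simp add: field_simps)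
  qed
qed


text \<open>\<open>matrix_inv\<close> is a left inverse of an invertible matrix.\<close>
lemma matrix_inv_left: "invertible (A::'a::field^'n::finite^'n) \<Longrightarrow> matrix_inv A ** A = mat 1"
  unfolding invertible_def matrix_inv_def by (rule someI2_ex) auto

subsection \<open>Kernels, ranges and supports of Hermitian matrices\<close>

lemma quad_nonneg:
  fixes a b :: real
  assumes h: "\<And>t. t > 0 \<Longrightarrow> 0 \<le> a * t + b * t^2"
  shows "0 \<le> a"
proof (rule ccontr)
  assume "\<not> 0 \<le> a"
  then have a: "a < 0" by simp
  define t where "t = - a / (\<bar>b\<bar> + 1)"
  have t: "t > 0" unfolding t_def by (rule divide_pos_pos) (use a in auto)
  have "b * t \<le> \<bar>b\<bar> * t" using t by (simp add: mult_right_mono)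
  also have "\<bar>b\<bar> * t < - a"
    using a by (simp add: t_def field_simps)
  finally have "t * (a + b * t) < 0" using t by (simp add: mult_pos_neg)
  with h[OF t] show False by (simp add: power2_eq_square algebra_simps)
qed

text \<open>Complex subspaces are in particular real subspaces.\<close>
lemma vec_subspace_subspace: "vec.subspace (S::(complex^'n::finite) set) \<Longrightarrow> subspace S"
  unfolding subspace_def vec.subspace_def by (simp add: scaleR_smult)

lemma range_vec_subspace: "vec.subspace (range ((*v) (A::complex^'n::finite^'m::finite)))"
  unfolding vec.subspace_def
  by (auto simp: vector_scalar_commute[symmetric] matrix_vector_right_distrib[symmetric]
      intro: range_eqI[where x=0])

lemma expand_quad:
  assumes "herm (P::complex^'n::finite^'n)"
  shows "inner (v + t *\<^sub>R u) (P *v (v + t *\<^sub>R u))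
    = inner v (P *v v) + 2 * t * inner u (P *v v) + t^2 * inner u (P *v u)"
proof -
  have "inner v (P *v u) = inner u (P *v v)"
    using herm_sym[OF assms, of v u] by (simp add: inner_commute)
  then show ?thesis
    by (simp add: matrix_vector_right_distrib mv_scaleR inner_add_left inner_add_right
        power2_eq_square algebra_simps)
qed

lemma inner_quad: "inner w ((P::complex^'n::finite^'n) *v w) = Re (qf P w)"
  by (simp add: qf_def inner_cinner)

text \<open>A vector on which the form of a psd matrix vanishes lies in its kernel.\<close>
lemma psd_ker:
  assumes P: "positive_semidef P" and q: "Re (qf P v) = 0"
  shows "P *v v = 0"
proof -
  have h: "herm P" using P by (simp add: psd_def2)
  define u where "u = - (P *v v)"
  have "0 \<le> (-2 * inner (P *v v) (P *v v)) * t + inner u (P *v u) * t^2" if "t > 0" for t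
  proof -
    have "0 \<le> Re (qf P (v + t *\<^sub>R u))" using P by (simp add: psd_def2)
    also have "\<dots> = inner v (P *v v) + 2 * t * inner u (P *v v) + t^2 * inner u (P *v u)"
      using expand_quad[OF h] inner_quad by metis
    also have "\<dots> = (-2 * inner (P *v v) (P *v v)) * t + inner u (P *v u) * t^2"
      using q by (simp add: inner_quad u_def algebra_simps)
    finally show ?thesis .
  qed
  from quad_nonneg[OF this] have "inner (P *v v) (P *v v) \<le> 0" by simp
  then show ?thesis by (metis inner_ge_zero inner_eq_zero_iff order.antisym)
qed

text \<open>For Hermitian matrices, \<open>ker Q \<subseteq> ker P\<close> implies \<open>ran P \<subseteq> ran Q\<close>
  (since the range is the orthogonal complement of the kernel).\<close>
lemma range_incl:
  assumes hQ: "herm Q" and hP: "herm P" and ker: "\<And>v. Q *v v = 0 \<Longrightarrow> P *v v = 0"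
  shows "range ((*v) (P::complex^'n::finite^'n)) \<subseteq> range ((*v) Q)"
proof
  fix w assume "w \<in> range ((*v) P)"
  then obtain u where w: "w = P *v u" by auto
  have sp: "span (range ((*v) Q)) = range ((*v) Q)"
    using vec_subspace_subspace[OF range_vec_subspace] by simp
  obtain y z where y: "y \<in> range ((*v) Q)"
    and z: "\<And>x. x \<in> range ((*v) Q) \<Longrightarrow> orthogonal z x" and wyz: "w = y + z"
    using orthogonal_subspace_decomp_exists[of "range ((*v) Q)" w] unfolding sp by blast
  have "inner (Q *v z) (Q *v z) = inner z (Q *v (Q *v z))"
    using herm_sym[OF hQ] by simp
  also have "\<dots> = 0" using z[of "Q *v (Q *v z)"] by (simp add: orthogonal_def)
  finally have "P *v z = 0" by (intro ker) simp
  then have "inner z w = 0" using herm_sym[OF hP, of z u] w by simp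
  moreover have "inner z y = 0" using z[OF y] by (simp add: orthogonal_def)
  ultimately have "z = 0" using wyz by (simp add: inner_add_right)
  then show "w \<in> range ((*v) Q)" using wyz y by simp
qed

text \<open>A unit vector maximising the Rayleigh quotient of a Hermitian matrix over an
  invariant subspace is an eigenvector (first-order optimality condition).\<close>
lemma rayleigh_max_eigenvector:
  assumes h: "herm (P::complex^'n::finite^'n)" and Z: "subspace Z"
    and inv: "\<And>z. z \<in> Z \<Longrightarrow> P *v z \<in> Z"
    and vZ: "v \<in> Z" and nv: "norm v = 1"
    and bound: "\<And>w. w \<in> Z \<Longrightarrow> inner w (P *v w) \<le> inner v (P *v v) * inner w w"
  shows "P *v v = inner v (P *v v) *\<^sub>R v"
proof -
  define l where "l = inner v (P *v v)"
  define u where "u = P *v v - l *\<^sub>R v"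
  have uZ: "u \<in> Z" unfolding u_def using Z inv vZ by (simp add: subspace_diff subspace_scale)
  have vv: "inner v v = 1" using nv by (simp add: dot_square_norm)
  have "0 \<le> (-2 * inner u u) * t + (l * inner u u - inner u (P *v u)) * t^2" if "t > 0" for t
  proof -
    have "v + t *\<^sub>R u \<in> Z" using Z vZ uZ by (simp add: subspace_add subspace_scale)
    then have "inner (v + t *\<^sub>R u) (P *v (v + t *\<^sub>R u))
        \<le> l * inner (v + t *\<^sub>R u) (v + t *\<^sub>R u)"
      unfolding l_def by (rule bound)
    moreover have "inner (v + t *\<^sub>R u) (P *v (v + t *\<^sub>R u))
        = l + 2 * t * inner u (P *v v) + t^2 * inner u (P *v u)"
      using expand_quad[OF h] l_def by simp
    moreover have "inner (v + t *\<^sub>R u) (v + t *\<^sub>R u) = 1 + 2 * t * inner u v + t^2 * inner u u"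
      using vv by (simp add: inner_add_left inner_add_right inner_commute[of v u]
          power2_eq_square algebra_simps)
    moreover have "inner u (P *v v) = inner u u + l * inner u v"
      by (simp add: u_def inner_diff_right inner_diff_left algebra_simps)
    ultimately have "l + 2 * t * (inner u u + l * inner u v) + t^2 * inner u (P *v u)
        \<le> l * (1 + 2 * t * inner u v + t^2 * inner u u)"
      by simp
    then show ?thesis by (simp add: algebra_simps)
  qed
  from quad_nonneg[OF this] have "inner u u \<le> 0" by simp
  then have "u = 0" by (metis inner_ge_zero inner_eq_zero_iff order.antisym)
  then show ?thesis by (simp add: u_def l_def)
qed

text \<open>A nonzero invariant subspace of a Hermitian matrix contains a real eigenvector:
  maximise the Rayleigh quotient over the compact unit sphere of the subspace.\<close>
lemma eigen_exists:
  assumes h: "herm P" and Z: "subspace Z"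
    and inv: "\<And>z. z \<in> Z \<Longrightarrow> (P::complex^'n::finite^'n) *v z \<in> Z"
    and z0: "z0 \<in> Z" "z0 \<noteq> 0"
  shows "\<exists>v\<in>Z. v \<noteq> 0 \<and> (\<exists>l::real. P *v v = l *\<^sub>R v)"
proof -
  define K where "K = Z \<inter> sphere 0 1"
  have "compact K" unfolding K_def
    by (intro closed_Int_compact closed_subspace Z compact_sphere)
  moreover have "z0 /\<^sub>R norm z0 \<in> K" using z0 Z by (simp add: K_def subspace_scale)
  moreover have "continuous_on K (\<lambda>v. inner v (P *v v))"
    by (intro continuous_intros linear_continuous_on linear_conv_bounded_linear[THEN iffD1]
        linearI) (simp_all add: matrix_vector_right_distrib mv_scaleR)
  ultimately obtain v where vK: "v \<in> K" and vmax: "\<And>y. y \<in> K \<Longrightarrow> inner y (P *v y) \<le> inner v (P *v v)"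
    using continuous_attains_sup[of K "\<lambda>v. inner v (P *v v)"] by blast
  have vZ: "v \<in> Z" and nv: "norm v = 1" using vK by (auto simp: K_def)
  have bound: "inner w (P *v w) \<le> inner v (P *v v) * inner w w" if wZ: "w \<in> Z" for w
  proof (cases "w = 0")
    case False
    then have nw: "norm w > 0" by simp
    have "w /\<^sub>R norm w \<in> K" using wZ False by (simp add: K_def subspace_scale[OF Z])
    then have le: "inner (w /\<^sub>R norm w) (P *v (w /\<^sub>R norm w)) \<le> inner v (P *v v)"
      by (rule vmax)
    have "inner w (P *v w) = (norm w)^2 * inner (w /\<^sub>R norm w) (P *v (w /\<^sub>R norm w))"
      using nw by (simp add: mv_scaleR power2_eq_square field_simps)
    also have "\<dots> \<le> (norm w)^2 * inner v (P *v v)"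
      by (rule mult_left_mono[OF le]) simp
    finally show ?thesis by (simp add: dot_square_norm mult.commute)
  qed simp
  have "P *v v = inner v (P *v v) *\<^sub>R v"
    by (rule rayleigh_max_eigenvector[OF h Z inv vZ nv bound])
  moreover have "v \<noteq> 0" using nv by auto
  ultimately show ?thesis using vZ by blast
qed


text \<open>Eigenvectors with nonzero eigenvalue lie in the range, so \<open>supp P \<subseteq> ran P\<close>.\<close>
lemma supp_subset_range: "supp P \<subseteq> range ((*v) (P::complex^'n::finite^'n))"
  unfolding supp_def
proof (rule vec.span_minimal[OF _ range_vec_subspace], clarify)
  fix v c assume "c \<noteq> 0" "P *v v = c *s v"
  then have "P *v ((1/c) *s v) = v" by (simp add: vector_scalar_commute vector_smult_assoc)
  then show "v \<in> range ((*v) P)" by (metis rangeI)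
qed

lemma supp_invariant:
  assumes "x \<in> supp P"
  shows "P *v x \<in> supp (P::complex^'n::finite^'n)"
proof -
  let ?E = "{v. v \<noteq> 0 \<and> (\<exists>c. c \<noteq> 0 \<and> P *v v = c *s v)}"
  have "vec.subspace {x. P *v x \<in> vec.span ?E}"
    unfolding vec.subspace_def
    by (simp add: matrix_vector_right_distrib vector_scalar_commute vec.span_zero vec.span_add
        vec.span_scale)
  moreover have "?E \<subseteq> {x. P *v x \<in> vec.span ?E}"
  proof clarify
    fix v c assume "v \<noteq> 0" "c \<noteq> 0" "P *v v = c *s v"
    then have "v \<in> vec.span ?E" by (intro vec.span_base) auto
    then show "P *v v \<in> vec.span ?E" using \<open>P *v v = c *s v\<close> by (simp add: vec.span_scale)
  qed
  ultimately have "vec.span ?E \<subseteq> {x. P *v x \<in> vec.span ?E}" by (rule vec.span_minimal[rotated])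
  with assms show ?thesis unfolding supp_def by blast
qed

text \<open>The part of the range orthogonal to the support is an invariant subspace without
  eigenvectors, hence trivial.\<close>
lemma herm_range_perp_supp:
  assumes h: "herm (P::complex^'n::finite^'n)"
    and wR: "w \<in> range ((*v) P)" and wperp: "\<forall>s\<in>supp P. inner w s = 0"
  shows "w = 0"
proof -
  let ?R = "range ((*v) P)"
  define Z where "Z = {w \<in> ?R. \<forall>s\<in>supp P. inner w s = 0}"
  have Rsub: "subspace ?R" by (rule vec_subspace_subspace[OF range_vec_subspace])
  have Zsub: "subspace Z"
    unfolding subspace_def Z_def
    by (simp add: subspace_0[OF Rsub] subspace_add[OF Rsub] subspace_scale[OF Rsub] inner_add_left)
  have Zinv: "P *v z \<in> Z" if zZ: "z \<in> Z" for z
  proof -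
    have "inner (P *v z) s = 0" if "s \<in> supp P" for s
      using herm_sym[OF h, of z s] supp_invariant[OF that] zZ by (simp add: Z_def)
    then show ?thesis by (auto simp: Z_def)
  qed
  have "v \<notin> Z" if "v \<noteq> 0" "P *v v = l *\<^sub>R v" for v l
  proof
    assume vZ: "v \<in> Z"
    show False
    proof (cases "l = 0")
      case True
      from vZ obtain u where "v = P *v u" by (auto simp: Z_def)
      then have "inner v v = inner u (P *v v)" using herm_sym[OF h, of u v] by simp
      with True \<open>P *v v = l *\<^sub>R v\<close> \<open>v \<noteq> 0\<close> show False by simp
    next
      case False
      have "P *v v = complex_of_real l *s v" using that by (simp add: scaleR_smult)
      with False \<open>v \<noteq> 0\<close> have "v \<in> supp P" unfolding supp_def by (auto intro: vec.span_base)
      with vZ \<open>v \<noteq> 0\<close> show False by (auto simp: Z_def)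
    qed
  qed
  moreover have "w \<in> Z" using wR wperp by (simp add: Z_def)
  ultimately show ?thesis using eigen_exists[OF h Zsub Zinv] by blast
qed

text \<open>For a Hermitian matrix the support (span of the eigenvectors with nonzero
  eigenvalue) is exactly the range.\<close>
lemma supp_range:
  assumes h: "herm (P::complex^'n::finite^'n)"
  shows "supp P = range ((*v) P)"
proof
  show "supp P \<subseteq> range ((*v) P)" by (rule supp_subset_range)
  show "range ((*v) P) \<subseteq> supp P"
  proof
    fix w assume wR: "w \<in> range ((*v) P)"
    have sp: "span (supp P) = supp P"
      unfolding supp_def by (simp add: vec_subspace_subspace[OF vec.subspace_span])
    obtain y z where y: "y \<in> supp P" and z: "\<And>x. x \<in> supp P \<Longrightarrow> orthogonal z x"
      and wyz: "w = y + z"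
      using orthogonal_subspace_decomp_exists[of "supp P" w] unfolding sp by blast
    have "z = w - y" using wyz by simp
    moreover have "y \<in> range ((*v) P)" using y supp_subset_range by blast
    ultimately have zR: "z \<in> range ((*v) P)"
      using subspace_diff[OF vec_subspace_subspace[OF range_vec_subspace] wR] by simp
    have "\<forall>s\<in>supp P. inner z s = 0" using z by (simp add: orthogonal_def)
    then have "z = 0" by (rule herm_range_perp_supp[OF h zR])
    with wyz y show "w \<in> supp P" by simp
  qed
qed


subsection \<open>Halved geometric series of a bounded orbit and psd series\<close>

text \<open>Damping a bounded sequence by \<open>2^-i\<close> gives an absolutely summable series.\<close>
lemma halving_series_summable:
  fixes f :: "nat \<Rightarrow> 'a::banach"
  assumes "bounded (range f)"
  shows "summable (\<lambda>i. (1/2::real)^i *\<^sub>R f i)"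
proof -
  obtain B where B: "\<And>i. norm (f i) \<le> B" using assms by (auto simp: bounded_iff)
  have bound: "norm ((1/2::real)^i *\<^sub>R f i) \<le> B * (1/2)^i" for i
    using mult_left_mono[OF B[of i], of "(1/2)^i"] by (simp add: mult.commute)
  have "summable (\<lambda>i. B * (1/2::real)^i)" by (rule summable_mult[OF summable_geometric]) simp
  then show ?thesis by (rule summable_comparison_test') (rule bound)
qed

text \<open>The sum \<open>\<rho> = \<Sum>i. 2^-i T^i(X)\<close> solves \<open>\<rho> - T(\<rho>)/2 = X\<close>.\<close>
lemma halving_series_fixpoint:
  fixes T :: "'a::euclidean_space \<Rightarrow> 'a"
  assumes lin: "linear T" and summ: "summable (\<lambda>i. (1/2::real)^i *\<^sub>R (T ^^ i) X)"
  shows "(\<Sum>i. (1/2::real)^i *\<^sub>R (T ^^ i) X)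
          - (1/2::real) *\<^sub>R T (\<Sum>i. (1/2::real)^i *\<^sub>R (T ^^ i) X) = X"
proof -
  define S where "S = (\<lambda>i. (1/2::real)^i *\<^sub>R (T ^^ i) X)"
  have summS: "summable S" using summ by (simp add: S_def)
  have bl: "bounded_linear T" using lin linear_conv_bounded_linear by blast
  have TS: "T (S i) = 2 *\<^sub>R S (Suc i)" for i
    by (simp add: S_def linear_scale[OF lin])
  have "T (suminf S) = (\<Sum>i. T (S i))"
    using bounded_linear.suminf[OF bl summS] by simp
  also have "\<dots> = 2 *\<^sub>R (\<Sum>i. S (Suc i))"
    unfolding TS using suminf_scaleR_right[of "\<lambda>i. S (Suc i)" 2] summS
    by (simp add: summable_Suc_iff)
  also have "(\<Sum>i. S (Suc i)) = suminf S - X"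
    using suminf_split_head[OF summS] by (simp add: S_def)
  finally show ?thesis by (simp add: S_def[symmetric])
qed

text \<open>For fixed \<open>v\<close>, the form \<open>X \<mapsto> \<langle>v, X v\<rangle>\<close> is a continuous real-linear function.\<close>
lemma bounded_linear_qf: "bounded_linear (\<lambda>X. qf X v)"
  by (rule linear_conv_bounded_linear[THEN iffD1], rule linearI)
    (simp_all add: qf_add qf_scaleR, simp add: scaleR_conv_of_real)

text \<open>A convergent series of psd matrices has a psd sum, since the adjoint and the quadratic
  forms are continuous linear functions.\<close>
lemma psd_suminf:
  assumes summ: "summable S" and psd: "\<And>i. positive_semidef (S i :: 'n::finite cmat)"
  shows "positive_semidef (suminf S)"
proof -
  have "adjoint (suminf S) = (\<Sum>i. adjoint (S i))"
    using bounded_linear.suminf[OF _ summ, of adjoint] linear_conv_bounded_linear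
      linearI[of adjoint] adjoint_add adjoint_scaleR by metis
  also have "\<dots> = suminf S" using psd by (simp add: psd_def2 herm_def)
  finally have "herm (suminf S)" by (simp add: herm_def)
  moreover have "qf (suminf S) v \<in> \<real> \<and> Re (qf (suminf S) v) \<ge> 0" for v
  proof -
    have sq: "summable (\<lambda>i. qf (S i) v)" by (rule bounded_linear.summable[OF bounded_linear_qf summ])
    have q: "qf (suminf S) v = (\<Sum>i. qf (S i) v)"
      by (rule bounded_linear.suminf[OF bounded_linear_qf summ])
    have "Im (qf (suminf S) v) = (\<Sum>i. Im (qf (S i) v))"
      unfolding q by (rule Im_suminf[OF sq])
    also have "\<dots> = 0" using psd by (simp add: psd_def2 complex_is_Real_iff)
    finally have "qf (suminf S) v \<in> \<real>" by (simp add: complex_is_Real_iff)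
    moreover have "Re (qf (suminf S) v) = (\<Sum>i. Re (qf (S i) v))"
      unfolding q by (rule Re_suminf[OF sq])
    moreover have "0 \<le> (\<Sum>i. Re (qf (S i) v))"
      using psd by (intro suminf_nonneg summable_Re sq) (simp add: psd_def2)
    ultimately show ?thesis by simp
  qed
  ultimately show ?thesis by (simp add: psd_def2)
qed

text \<open>The kernel of a convergent sum of psd matrices is contained in the kernel of every term.\<close>
lemma psd_suminf_kernel:
  assumes summ: "summable S" and psd: "\<And>i. positive_semidef (S i :: 'n::finite cmat)"
    and ker: "suminf S *v v = 0"
  shows "S i *v v = 0"
proof -
  have sq: "summable (\<lambda>i. Re (qf (S i) v))"
    by (intro summable_Re bounded_linear.summable[OF bounded_linear_qf summ])
  have "(\<Sum>i. Re (qf (S i) v)) = Re (qf (suminf S) v)"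
    using Re_suminf bounded_linear.suminf[OF bounded_linear_qf summ]
      bounded_linear.summable[OF bounded_linear_qf summ] by metis
  also have "\<dots> = 0" using ker by (simp add: qf_def cinner_def)
  finally have "\<forall>i. Re (qf (S i) v) = 0"
    using suminf_eq_zero_iff[OF sq] psd by (simp add: psd_def2)
  then show ?thesis by (intro psd_ker[OF psd]) simp
qed


subsection \<open>The reachable space is the range of \<open>\<rho>\<close>\<close>

lemma Fstr_snoc: "Fstr Es M1 (f @ [k]) X = Fk Es M1 k (Fstr Es M1 f X)"
  by (simp add: Fstr_def)

lemma Fstr_psd: "positive_semidef X \<Longrightarrow> positive_semidef (Fstr Es M1 f X)"
  by (induction f rule: rev_induct) (auto simp: Fstr_def Fk_psd)

text \<open>\<open>G^n(X) \<ge> m^-n F_f(X)\<close> in the psd order for every schedule \<open>f\<close> of length \<open>n\<close>: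
  \<open>G\<close> averages over the \<open>m\<close> choices of the next component and all summands are psd.\<close>
lemma Gpow_ge_Fstr:
  assumes X: "positive_semidef X" and f: "set f \<subseteq> {1..m}"
  shows "positive_semidef ((Gmap m Es M1 ^^ length f) X - (1/real m)^length f *\<^sub>R Fstr Es M1 f X)"
  using f
proof (induction f rule: rev_induct)
  case Nil then show ?case by (simp add: psd_zero Fstr_def)
next
  case (snoc k f)
  let ?G = "Gmap m Es M1"
  define F where "F = Fstr Es M1 f X"
  define c where "c = (1/real m)^length f"
  define D where "D = (?G ^^ length f) X - c *\<^sub>R F"
  have D: "positive_semidef D" using snoc by (simp add: D_def F_def c_def)
  have F: "positive_semidef F" using X by (simp add: F_def Fstr_psd)
  have k: "k \<in> {1..m}" using snoc by simp
  have "?G F = (1/real m) *\<^sub>R (Fk Es M1 k F + (\<Sum>k'\<in>{1..m}-{k}. Fk Es M1 k' F))"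
    unfolding Gmap_def using sum.remove[OF finite_atLeastAtMost k, of "\<lambda>k'. Fk Es M1 k' F"] by simp
  moreover have "?G ((?G ^^ length f) X) = ?G D + c *\<^sub>R ?G F"
    by (simp add: D_def linear_diff[OF linear_Gmap] linear_scale[OF linear_Gmap])
  ultimately have "(?G ^^ length (f @ [k])) X - (1/real m)^length (f @ [k]) *\<^sub>R Fstr Es M1 (f @ [k]) X
      = ?G D + (c * (1/real m)) *\<^sub>R (\<Sum>k'\<in>{1..m}-{k}. Fk Es M1 k' F)"
    by (simp add: Fstr_snoc F_def c_def scaleR_add_right algebra_simps)
  also have "positive_semidef \<dots>"
    by (intro psd_add Gmap_psd D psd_scaleR psd_sum Fk_psd F) (auto simp: c_def)
  finally show ?case .
qed

text \<open>If \<open>c A \<le> B\<close> for psd \<open>A\<close> and \<open>c > 0\<close>, then \<open>ker B \<subseteq> ker A\<close>.\<close>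
lemma psd_le_kernel:
  assumes D: "positive_semidef (B - c *\<^sub>R A)" and c: "c > 0" and A: "positive_semidef A"
    and Bv: "B *v v = 0"
  shows "A *v v = 0"
proof (rule psd_ker[OF A])
  have "0 \<le> Re (qf (B - c *\<^sub>R A) v)" using D by (simp add: psd_def2)
  moreover have "qf B v = 0" using Bv by (simp add: qf_def cinner_def)
  ultimately have "c * Re (qf A v) \<le> 0" by (simp add: qf_diff qf_scaleR)
  with c have "Re (qf A v) \<le> 0" by (simp add: mult_le_0_iff)
  with A show "Re (qf A v) = 0" by (simp add: psd_def2 order.antisym)
qed

text \<open>The iterates of \<open>G\<close> stay in the linear span of the reachable states \<open>F_f(X)\<close>.\<close>
lemma Gpow_in_span_Fstr:
  "(Gmap m Es M1 ^^ i) X \<in> span ((\<lambda>f. Fstr Es M1 f X) ` {f. set f \<subseteq> {1..m}})"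
proof (induction i)
  case 0
  have "Fstr Es M1 [] X \<in> (\<lambda>f. Fstr Es M1 f X) ` {f. set f \<subseteq> {1..m}}"
    by (rule image_eqI[where x="[]"]) auto
  then show ?case by (simp add: Fstr_def span_base)
next
  case (Suc i)
  let ?V = "span ((\<lambda>f. Fstr Es M1 f X) ` {f. set f \<subseteq> {1..m}})"
  have "subspace {Y. Gmap m Es M1 Y \<in> ?V}"
    unfolding subspace_def
    by (simp add: linear_add[OF linear_Gmap] linear_scale[OF linear_Gmap] linear_0[OF linear_Gmap]
        span_add span_scale span_zero)
  moreover have "(\<lambda>f. Fstr Es M1 f X) ` {f. set f \<subseteq> {1..m}} \<subseteq> {Y. Gmap m Es M1 Y \<in> ?V}"
  proof clarify
    fix f :: "nat list" assume f: "set f \<subseteq> {1..m}"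
    have "Fstr Es M1 (f @ [k]) X \<in> ?V" if "k \<in> {1..m}" for k
      using f that by (intro span_base imageI) auto
    then show "Gmap m Es M1 (Fstr Es M1 f X) \<in> ?V"
      unfolding Gmap_def Fstr_snoc[symmetric] by (intro span_scale span_sum) auto
  qed
  ultimately have "?V \<subseteq> {Y. Gmap m Es M1 Y \<in> ?V}" by (rule span_minimal[rotated])
  with Suc.IH show ?case by (simp add: subset_iff)
qed

text \<open>Linear subspaces of a finite-dimensional space are closed, so they contain the sums
  of their convergent series.\<close>
lemma suminf_in_span:
  fixes S :: "nat \<Rightarrow> 'a::euclidean_space"
  assumes "summable S" and "\<And>i. S i \<in> span B"
  shows "suminf S \<in> span B"
proof (rule closed_sequentially[OF closed_span])
  show "(\<Sum>i<n. S i) \<in> span B" for n by (intro span_sum assms(2))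
  show "(\<lambda>n. \<Sum>i<n. S i) \<longlonglongrightarrow> suminf S" by (rule summable_LIMSEQ[OF assms(1)])
qed

text \<open>The columns of a linear combination of matrices lie in the span of their ranges.\<close>
lemma span_matrices_range:
  assumes "X \<in> span Ms"
  shows "(X::complex^'n::finite^'m::finite) *v u \<in> vec.span (\<Union>M\<in>Ms. range ((*v) M))"
proof -
  let ?R = "vec.span (\<Union>M\<in>Ms. range ((*v) M))"
  have "subspace {X. X *v u \<in> ?R}"
    unfolding subspace_def
    by (simp add: matrix_vector_mult_add_rdistrib scaleR_mv scaleR_smult vec.span_zero
        vec.span_add vec.span_scale)
  moreover have "Ms \<subseteq> {X. X *v u \<in> ?R}" by (auto intro!: vec.span_base)
  ultimately have "span Ms \<subseteq> {X. X *v u \<in> ?R}" by (rule span_minimal[rotated])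
  with assms show ?thesis by blast
qed

text \<open>The columns \<open>A e_j\<close> of a matrix span its range.\<close>
lemma span_cols:
  "vec.span (range (\<lambda>j. (A::complex^'n::finite^'m::finite) *v axis j 1)) = range ((*v) A)"
proof
  show "vec.span (range (\<lambda>j. A *v axis j 1)) \<subseteq> range ((*v) A)"
    by (rule vec.span_minimal[OF _ range_vec_subspace]) auto
  show "range ((*v) A) \<subseteq> vec.span (range (\<lambda>j. A *v axis j 1))"
  proof clarify
    fix u
    have "A *v u = A *v (\<Sum>j\<in>UNIV. u$j *s axis j 1)" by (simp add: basis_expansion)
    also have "\<dots> = (\<Sum>j\<in>UNIV. u$j *s (A *v axis j 1))"
      by (simp add: vec.sum vector_scalar_commute)
    finally show "A *v u \<in> vec.span (range (\<lambda>j. A *v axis j 1))"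
      by (simp add: vec.span_sum vec.span_scale vec.span_base)
  qed
qed


text \<open>Main structural fact: the reachable space is the range of the psd matrix \<open>\<rho>\<close>.\<close>
lemma reachable_space_eq_range:
  assumes P: "is_concurrent_program m Es M0 M1" and r0: "positive_semidef \<rho>0"
    and summ: "summable (\<lambda>i. (1/2::real)^i *\<^sub>R (Gmap m Es M1 ^^ i) \<rho>0)"
  shows "reachable_space m Es M1 \<rho>0
    = range ((*v) (\<Sum>i. (1/2::real)^i *\<^sub>R (Gmap m Es M1 ^^ i) \<rho>0))"
proof -
  define S where "S = (\<lambda>i. (1/2::real)^i *\<^sub>R (Gmap m Es M1 ^^ i) \<rho>0)"
  define F where "F = (\<lambda>f. Fstr Es M1 f \<rho>0)"
  let ?K = "{f. set f \<subseteq> {1..m}}"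
  let ?R = "vec.span (\<Union>f\<in>?K. range ((*v) (F f)))"
  have summS: "summable S" using summ by (simp add: S_def)
  have Spsd: "positive_semidef (S i)" for i
    unfolding S_def by (intro psd_scaleR Gmap_pow_psd r0) simp
  have Fpsd: "positive_semidef (F f)" for f by (simp add: F_def Fstr_psd r0)
  have "supp (F f) = range ((*v) (F f))" for f
    using Fpsd by (intro supp_range) (simp add: psd_def2)
  then have reach: "reachable_space m Es M1 \<rho>0 = ?R"
    by (simp add: reachable_space_def F_def)
  have "?R \<subseteq> range ((*v) (suminf S))"
  proof (rule vec.span_minimal[OF _ range_vec_subspace], rule UN_least)
    fix f assume f: "f \<in> ?K"
    have m: "m \<ge> 1" using P by (simp add: is_concurrent_program_def)
    show "range ((*v) (F f)) \<subseteq> range ((*v) (suminf S))"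
    proof (rule range_incl)
      show "herm (suminf S)" "herm (F f)"
        using psd_suminf[OF summS Spsd] Fpsd by (simp_all add: psd_def2)
      fix v assume "suminf S *v v = 0"
      then have "S (length f) *v v = 0" by (rule psd_suminf_kernel[OF summS Spsd])
      then have Gv: "(Gmap m Es M1 ^^ length f) \<rho>0 *v v = 0" by (simp add: S_def scaleR_mv)
      have "positive_semidef ((Gmap m Es M1 ^^ length f) \<rho>0 - (1/real m)^length f *\<^sub>R F f)"
        using Gpow_ge_Fstr[OF r0] f by (simp add: F_def)
      moreover have "(1/real m)^length f > 0" using m by simp
      ultimately show "F f *v v = 0" using Fpsd Gv by (rule psd_le_kernel)
    qed
  qed
  moreover have "range ((*v) (suminf S)) \<subseteq> ?R"
  proof clarify
    fix u
    have "suminf S \<in> span (F ` ?K)"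
      unfolding S_def F_def by (intro suminf_in_span summ span_scale Gpow_in_span_Fstr)
    then show "suminf S *v u \<in> ?R" using span_matrices_range by fastforce
  qed
  ultimately show ?thesis using reach by (simp add: S_def)
qed

subsection \<open>Main theorem\<close>

theorem mainTheorem2:
  fixes m :: nat and Es :: "nat \<Rightarrow> (complex^'n^'n) list"
    and M0 M1 \<rho>0 :: "complex^'n^'n"
  assumes "is_concurrent_program m Es M0 M1"
    and "density_operator \<rho>0"
  defines "A \<equiv> (mat 1 :: complex^('n\<times>'n)^('n\<times>'n)) - (1/2::real) *\<^sub>R Gmatrix m Es M1"
  defines "x \<equiv> matrix_inv A *v (kron \<rho>0 (mat 1) *v Phi)"
  defines "y \<equiv> (\<lambda>j. (\<chi> i. x $ (i, j)) :: complex^'n)"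
  defines "\<rho> \<equiv> (\<Sum>i. (1/2::real) ^ i *\<^sub>R ((Gmap m Es M1 ^^ i) \<rho>0))"
  shows "invertible A
       \<and> vec.span (range y) = reachable_space m Es M1 \<rho>0
       \<and> summable (\<lambda>i. (1/2::real) ^ i *\<^sub>R ((Gmap m Es M1 ^^ i) \<rho>0))
       \<and> x = kron \<rho> (mat 1) *v Phi
       \<and> reachable_space m Es M1 \<rho>0 = supp \<rho>"
proof -
  note P = assms(1)
  have r0: "positive_semidef \<rho>0" using assms(2) by (simp add: density_operator_def)
  have summ: "summable (\<lambda>i. (1/2::real) ^ i *\<^sub>R ((Gmap m Es M1 ^^ i) \<rho>0))"
    by (rule halving_series_summable[OF Gmap_orbit_bounded[OF P r0]])
  have inv: "invertible A" unfolding A_def by (rule I_minus_half_Gmatrix_invertible[OF P])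
  have "A *v vecm \<rho> = vecm (\<rho> - (1/2::real) *\<^sub>R Gmap m Es M1 \<rho>)"
    by (simp add: A_def matrix_vector_mult_diff_rdistrib scaleR_mv Gmatrix_vecm
        linear_diff[OF linear_vecm] linear_scale[OF linear_vecm])
  also have "\<rho> - (1/2::real) *\<^sub>R Gmap m Es M1 \<rho> = \<rho>0"
    unfolding \<rho>_def by (rule halving_series_fixpoint[OF linear_Gmap summ])
  finally have "A *v vecm \<rho> = vecm \<rho>0" .
  then have "x = matrix_inv A *v (A *v vecm \<rho>)" by (simp add: x_def kron_Phi)
  also have "\<dots> = vecm \<rho>" by (simp add: matrix_vector_mul_assoc matrix_inv_left[OF inv])
  finally have "x = vecm \<rho>" .
  moreover have "y = (\<lambda>j. \<rho> *v axis j 1)" by (simp add: y_def \<open>x = vecm \<rho>\<close> vecm_def mv_axis)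
  moreover have "herm \<rho>"
    using psd_suminf[OF summ Gmap_pow_psd[OF r0, THEN psd_scaleR]] by (simp add: \<rho>_def psd_def2)
  then have "supp \<rho> = range ((*v) \<rho>)" by (rule supp_range)
  ultimately show ?thesis
    using inv summ reachable_space_eq_range[OF P r0 summ]
    by (simp add: \<rho>_def[symmetric] kron_Phi span_cols)
qed

end
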